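(* Let $a_1(t), a_2(t) \in C(\mathbb{R})$ satisfy $c_0 \leq a_i(t) \leq c_1$ for all $t \in \mathbb{R}$, $i=1,2$, and some constants $0 < c_0 \leq c_1$, and let $h_1(t), h_2(t) \in C(\mathbb{R})$ be uniformly bounded on $\mathbb{R}$. Let $f(x,y)$ and $g(x,y)$ be real-valued continuous functions on $\mathbb{R}^2$ having first-order partial derivatives $f_x,f_y,g_x,g_y$ on $\mathbb{R}^2$. Assume that (i) $f(x,y) \to \infty$ as $x \to \infty$ and $f(x,y) \to -\infty$ as $x \to -\infty$, uniformly in $y \in \mathbb{R}$; (ii) $g(x,y) \to \infty$ as $y \to \infty$ and $g(x,y) \to -\infty$ as $y \to -\infty$, uniformly in $x \in \mathbb{R}$; (iii) for some $\alpha \in \mathbb{R}$, $x f(x,y) \geq \alpha$ and $y g(x,y) \geq \alpha$ for all $(x,y) \in \mathbb{R}^2$; (iv) for all $t, x, y \in \mathbb{R}$ the quadratic form in $(w,z)$ $$a_1(t) f_x(x,y) w^2 + \left(a_1(t) f_y(x,y) + a_2(t) g_x(x,y)\right) w z + a_2(t) g_y(x,y) z^2$$ is positive semi-definite. Then the system $$u'' - a_1(t) f(u,v) = h_1(t), \qquad v'' - a_2(t) g(u,v) = h_2(t), \qquad t \in \mathbb{R},$$ has a classical solution $(u,v)$ that is uniformly bounded for all $t \in (-\infty,\infty)$.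
   Context: A classical solution is a pair $u, v \in C^2(\mathbb{R})$ of real-valued functions satisfying both equations at every $t \in \mathbb{R}$; uniformly bounded means that $|u(t)|$ and $|v(t)|$ are bounded by a single constant for all $t\in\mathbb{R}$. *)

theory Defs
  imports "HOL-Analysis.Analysis"
begin

definition C2_on_reals :: "(real \<Rightarrow> real) \<Rightarrow> bool" where
  "C2_on_reals u \<longleftrightarrow>
     (\<forall>t. u field_differentiable (at t)) \<and>
     (\<forall>t. deriv u field_differentiable (at t)) \<and>
     continuous_on UNIV (deriv (deriv u))"

definition classical_solution ::
  "(real \<Rightarrow> real) \<Rightarrow> (real \<Rightarrow> real) \<Rightarrow> (real \<Rightarrow> real \<Rightarrow> real) \<Rightarrow> (real \<Rightarrow> real \<Rightarrow> real) \<Rightarrow>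
   (real \<Rightarrow> real) \<Rightarrow> (real \<Rightarrow> real) \<Rightarrow> (real \<Rightarrow> real) \<Rightarrow> (real \<Rightarrow> real) \<Rightarrow> bool" where
  "classical_solution a1 a2 f g h1 h2 u v \<longleftrightarrow>
     C2_on_reals u \<and> C2_on_reals v \<and>
     (\<forall>t. deriv (deriv u) t - a1 t * f (u t) (v t) = h1 t) \<and>
     (\<forall>t. deriv (deriv v) t - a2 t * g (u t) (v t) = h2 t)"

end

theory Submission
  imports Defs "HOL-Complex_Analysis.Great_Picard"
begin

text \<open>
  Replace the arguments of \<open>f\<close> and \<open>g\<close> by their truncations to \<open>[-B, B]\<close> and delay them by a
  small \<open>\<epsilon>\<close>. On a bounded interval the delayed equation is solved by steps, so its solutions with
  zero initial value depend continuously on the initial slope even though \<open>f\<close> and \<open>g\<close> are merely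
  continuous. The right-hand side being bounded, Brouwer's theorem provides a slope for which the
  solution vanishes at the right end point as well. At a positive maximum of \<open>u\<close> beyond the
  coercivity threshold of \<open>f\<close> one would have \<open>u'' > 0\<close>; since \<open>\<epsilon>\<close> is small compared with
  \<open>1 / \<bar>u'\<bar>\<close>, the delay does not spoil this, and \<open>\<bar>u\<bar>\<close> (likewise \<open>\<bar>v\<bar>\<close>) is bounded independently of the
  interval. Hence so are the derivatives, and a diagonal subsequence over growing intervals with
  \<open>\<epsilon> \<rightarrow> 0\<close> converges to an entire solution for which the truncation is inactive.
\<close>

section \<open>Compactness of approximate solutions on growing intervals\<close>

lemma has_vector_derivative_bound_Icc:
  fixes f :: "real \<Rightarrow> 'a::euclidean_space"
  assumes deriv: "\<And>t. t \<in> {a..b} \<Longrightarrow> (f has_vector_derivative f' t) (at t within {a..b})"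
    and bound: "\<And>t. t \<in> {a..b} \<Longrightarrow> norm (f' t) \<le> L"
    and s: "s \<in> {a..b}" and t: "t \<in> {a..b}"
  shows "norm (f s - f t) \<le> L * \<bar>s - t\<bar>"
proof -
  have "norm (f s - f t) \<le> L * norm (s - t)"
  proof (rule differentiable_bound[of "{a..b}" f "\<lambda>t h. h *\<^sub>R f' t"])
    fix r assume r: "r \<in> {a..b}"
    show "(f has_derivative (\<lambda>h. h *\<^sub>R f' r)) (at r within {a..b})"
      using deriv[OF r] by (simp add: has_vector_derivative_def)
    show "onorm (\<lambda>h. h *\<^sub>R f' r) \<le> L"
    proof (rule onorm_bound)
      show "0 \<le> L" using bound[OF r] norm_ge_zero order_trans by blast
      show "norm (h *\<^sub>R f' r) \<le> L * norm h" for h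
        using mult_right_mono[OF bound[OF r], of "\<bar>h\<bar>"] by (simp add: mult.commute)
    qed
  qed (use s t in auto)
  then show ?thesis by simp
qed

text \<open>An Arzela-Ascoli argument: bounds on \<open>\<Phi>\<close> over compact sets make the
  \<open>X n\<close> Lipschitz on each fixed interval with a constant independent of
  \<open>n\<close>. A diagonal subsequence converges at the rationals, hence everywhere, and the
  integral equation passes to the limit by dominated convergence. The separate \<open>Z n\<close>
  leaves room for a delayed argument in \<open>\<Phi>\<close>.\<close>

lemma limit_of_approximate_solutions:
  fixes \<Phi> :: "real \<Rightarrow> 'a \<Rightarrow> 'a::euclidean_space" and X Z :: "nat \<Rightarrow> real \<Rightarrow> 'a"
  assumes cont: "continuous_on UNIV (\<lambda>(t, x). \<Phi> t x)"
    and deriv: "\<And>n t. \<bar>t\<bar> \<le> real n \<Longrightarrow>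
        (X n has_vector_derivative \<Phi> t (Z n t)) (at t within {-real n..real n})"
    and "compact S" and XS: "\<And>n t. \<bar>t\<bar> \<le> real n \<Longrightarrow> X n t \<in> S"
    and close: "\<And>n t. \<bar>t\<bar> \<le> real n \<Longrightarrow> norm (Z n t - X n t) \<le> \<delta> n"
    and lim: "\<delta> \<longlonglongrightarrow> 0"
  obtains x where "\<And>t. (x has_vector_derivative \<Phi> t (x t)) (at t)" "\<And>t. x t \<in> S"
proof -
  obtain B where "\<And>x. x \<in> S \<Longrightarrow> norm x \<le> B"
    using \<open>compact S\<close> by (meson bounded_pos compact_imp_bounded)
  with XS have bnd: "norm (X n t) \<le> B" if "\<bar>t\<bar> \<le> real n" for n t
    using that by blast
  \<comment> \<open>All \<open>Z n t\<close> thus stay in one ball of radius \<open>B + D\<close>,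
    on which \<open>\<Phi>\<close> is bounded for \<open>t\<close> in a compact interval.\<close>
  obtain D where D: "\<And>n. \<bar>\<delta> n\<bar> \<le> D"
    using convergent_imp_Bseq[OF convergentI[OF lim]] by (auto simp: Bseq_def)
  have Zbnd: "norm (Z n t) \<le> B + D" if "\<bar>t\<bar> \<le> real n" for n t
    using bnd[OF that] close[OF that] D[of n] norm_triangle_ineq2[of "Z n t" "X n t"] by linarith
  have "\<exists>L>0. \<forall>t x. \<bar>t\<bar> \<le> R \<longrightarrow> norm x \<le> B + D \<longrightarrow> norm (\<Phi> t x) \<le> L" for R
  proof -
    have "compact ((\<lambda>(t, x). \<Phi> t x) ` ({-R..R} \<times> cball 0 (B + D)))"
      by (intro compact_continuous_image continuous_on_subset[OF cont] compact_Times) auto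
    then obtain L where L: "L > 0" "\<And>y. y \<in> (\<lambda>(t, x). \<Phi> t x) ` ({-R..R} \<times> cball 0 (B + D)) \<Longrightarrow> norm y \<le> L"
      by (meson bounded_pos compact_imp_bounded)
    show ?thesis
    proof (intro exI[of _ L] conjI allI impI)
      fix t and x :: 'a assume "\<bar>t\<bar> \<le> R" "norm x \<le> B + D"
      then show "norm (\<Phi> t x) \<le> L" by (intro L(2)) (auto intro!: image_eqI[of _ _ "(t, x)"])
    qed (rule L)
  qed
  then obtain L where L0: "\<And>R. L R > 0"
    and L: "\<And>R t x. \<bar>t\<bar> \<le> R \<Longrightarrow> norm x \<le> B + D \<Longrightarrow> norm (\<Phi> t x) \<le> L R"
    by metis
  have derivN: "(X n has_vector_derivative \<Phi> t (Z n t)) (at t within {-R..R})"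
    if "R \<le> real n" "t \<in> {-R..R}" for n t R
    by (rule has_vector_derivative_within_subset[OF deriv]) (use that in auto)
  have lip: "norm (X n s - X n t) \<le> L R * \<bar>s - t\<bar>"
    if "R \<le> real n" "\<bar>s\<bar> \<le> R" "\<bar>t\<bar> \<le> R" for n s t R
  proof (rule has_vector_derivative_bound_Icc)
    show "norm (\<Phi> r (Z n r)) \<le> L R" if "r \<in> {-R..R}" for r
      by (rule L) (use that \<open>R \<le> real n\<close> in \<open>auto intro!: Zbnd\<close>)
  qed (use that derivN in auto)
  \<comment> \<open>The diagonal argument needs functions bounded on the whole line for every
    \<open>n\<close>, whereas \<open>X n\<close> is controlled only on \<open>{-n..n}\<close>; the
    value 0 elsewhere does not affect limits.\<close>
  define F where "F n t = (if \<bar>t\<bar> \<le> real n then X n t else 0)" for n t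
  have F: "norm (F n t) \<le> max B 0" for n t
    using bnd[of t n] by (auto simp: F_def)
  obtain k where k: "strict_mono (k::nat\<Rightarrow>nat)"
    and kl: "\<And>x. x \<in> \<rat> \<Longrightarrow> \<exists>l. (\<lambda>n. F (k n) x) \<longlonglongrightarrow> l"
    by (rule function_convergent_subsequence[OF countable_rat, of F "max B 0"]) (use F in auto)
  have kn: "n \<le> k n" for n using k by (rule seq_suble)
  have ev: "\<forall>\<^sub>F n in sequentially. R \<le> real (k n)" for R
  proof -
    obtain m where m: "R \<le> real m" using real_arch_simple by blast
    show ?thesis
      by (rule eventually_sequentiallyI[of m]) (use kn m in \<open>force intro: order_trans\<close>)
  qed
  have conv: "convergent (\<lambda>n. X (k n) t)" for t
  proof -
    have "Cauchy (\<lambda>n. X (k n) t)"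
    proof (rule metric_CauchyI)
      fix e :: real assume e: "e > 0"
      define R where "R = \<bar>t\<bar> + 1"
      \<comment> \<open>The factor \<open>3 * L R\<close> makes replacing \<open>t\<close> by a
        rational \<open>q\<close> cost less than \<open>e / 3\<close> for every large index; the cap
        1 keeps \<open>q\<close> in \<open>{-R..R}\<close>.\<close>
      define d where "d = min 1 (e / (3 * L R))"
      have d: "d > 0" using e L0[of R] by (simp add: d_def)
      obtain q where q: "q \<in> \<rat>" "t < q" "q < t + d"
        using Rats_dense_in_real[of t "t + d"] d by auto
      have tq: "\<bar>t - q\<bar> < d" "\<bar>t\<bar> \<le> R" "\<bar>q\<bar> \<le> R" using q by (auto simp: R_def d_def)
      have Ld: "L R * \<bar>t - q\<bar> < e / 3"
      proof -
        have "\<bar>t - q\<bar> < e / (3 * L R)" using tq by (simp add: d_def)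
        then show ?thesis using L0[of R] by (simp add: field_simps)
      qed
      have "Cauchy (\<lambda>n. F (k n) q)"
        using kl[OF q(1)] by (auto intro: LIMSEQ_imp_Cauchy)
      then obtain N1 where N1: "\<And>m n. m \<ge> N1 \<Longrightarrow> n \<ge> N1 \<Longrightarrow> dist (F (k m) q) (F (k n) q) < e / 3"
        using metric_CauchyD[of _ "e / 3"] e by fastforce
      obtain N2 where N2: "\<And>n. n \<ge> N2 \<Longrightarrow> R \<le> real (k n)"
        using ev[of R] by (auto simp: eventually_sequentially)
      show "\<exists>M. \<forall>m\<ge>M. \<forall>n\<ge>M. dist (X (k m) t) (X (k n) t) < e"
      proof (intro exI[of _ "max N1 N2"] allI impI)
        fix m n assume mn: "max N1 N2 \<le> m" "max N1 N2 \<le> n"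
        have "norm (X (k j) t - X (k j) q) < e / 3" "F (k j) q = X (k j) q" if "max N1 N2 \<le> j" for j
          using lip[of R "k j" t q] N2[of j] that tq Ld by (auto simp: F_def)
        from this[OF mn(1)] this[OF mn(2)] N1[of m n] mn
        have "dist (X (k m) t) (X (k m) q) < e / 3" "dist (X (k n) t) (X (k n) q) < e / 3"
          "dist (X (k m) q) (X (k n) q) < e / 3"
          by (auto simp: dist_norm)
        then show "dist (X (k m) t) (X (k n) t) < e"
          using dist_triangle[of "X (k m) t" "X (k n) t" "X (k m) q"]
            dist_triangle[of "X (k m) q" "X (k n) t" "X (k n) q"]
          by (auto simp: dist_commute)
      qed
    qed
    then show ?thesis by (simp add: Cauchy_convergent_iff)
  qed
  define x where "x t = (THE l. (\<lambda>n. X (k n) t) \<longlonglongrightarrow> l)" for t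
  have x: "(\<lambda>n. X (k n) t) \<longlonglongrightarrow> x t" for t
    using conv[of t] unfolding x_def lim_def[symmetric] by (simp add: convergent_LIMSEQ_iff)
  have xS: "x t \<in> S" for t
  proof (rule Lim_in_closed_set[OF compact_imp_closed[OF \<open>compact S\<close>] _ _ x[of t]])
    show "\<forall>\<^sub>F n in sequentially. X (k n) t \<in> S"
      using ev[of "\<bar>t\<bar>"] by (auto elim!: eventually_mono intro: XS)
  qed simp
  have xlip: "norm (x s - x t) \<le> L R * \<bar>s - t\<bar>" if "\<bar>s\<bar> \<le> R" "\<bar>t\<bar> \<le> R" for s t R
    by (rule Lim_norm_ubound[OF _ tendsto_diff[OF x x]])
      (use ev[of R] that in \<open>auto elim!: eventually_mono intro: lip\<close>)
  have Zx: "(\<lambda>n. Z (k n) t) \<longlonglongrightarrow> x t" for t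
  proof -
    have "(\<lambda>n. Z (k n) t - X (k n) t) \<longlonglongrightarrow> 0"
    proof (rule Lim_null_comparison)
      show "\<forall>\<^sub>F n in sequentially. norm (Z (k n) t - X (k n) t) \<le> \<delta> (k n)"
        using ev[of "\<bar>t\<bar>"] by (auto elim!: eventually_mono intro: close)
      show "(\<lambda>n. \<delta> (k n)) \<longlonglongrightarrow> 0"
        using LIMSEQ_subseq_LIMSEQ[OF lim k] by (simp add: o_def)
    qed
    from tendsto_add[OF this x[of t]] show ?thesis by simp
  qed
  have xcont: "continuous_on {-R..R} x" for R
  proof (rule continuous_on_subset[of UNIV])
    show "continuous_on UNIV x"
    proof (rule continuous_at_imp_continuous_on, rule ballI)
      fix t
      have "((\<lambda>s. x s - x t) \<longlongrightarrow> 0) (at t)"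
      proof (rule Lim_null_comparison)
        have "\<forall>\<^sub>F s in at t. dist s t < 1" by (auto simp: eventually_at intro: exI[of _ 1])
        then show "\<forall>\<^sub>F s in at t. norm (x s - x t) \<le> L (\<bar>t\<bar> + 1) * \<bar>s - t\<bar>"
          by (rule eventually_mono) (auto intro!: xlip simp: dist_real_def)
        show "((\<lambda>s. L (\<bar>t\<bar> + 1) * \<bar>s - t\<bar>) \<longlongrightarrow> 0) (at t)"
          by (auto intro!: tendsto_eq_intros)
      qed
      then show "isCont x t" by (simp add: isCont_def LIM_zero_iff)
    qed
  qed simp
  have \<Phi>cont: "continuous_on A (\<lambda>t. \<Phi> t (y t))" if "continuous_on A y" for A y
    using continuous_on_compose2[OF cont continuous_on_Pair[OF continuous_on_id that]] by simp
  have \<Phi>isCont: "isCont (\<Phi> s) z" for s z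
    using continuous_on_compose2[OF cont, of UNIV "Pair s"]
    by (simp add: continuous_on_eq_continuous_at continuous_intros)
  have deriv_x: "(x has_vector_derivative \<Phi> t (x t)) (at t)" for t
  proof -
    obtain N where N: "\<bar>t\<bar> < real N" using reals_Archimedean2 by blast
    \<comment> \<open>Shifting the index by \<open>N\<close> puts \<open>{-N..N}\<close> inside the
      interval of every term, so no initial terms need to be excluded.\<close>
    have Nk: "real N \<le> real (k (n + N))" for n using kn[of "n + N"] by simp
    have eq: "x r = x (- real N) + integral {- real N..r} (\<lambda>s. \<Phi> s (x s))"
      if r: "r \<in> {- real N..real N}" for r
    proof -
      have int: "((\<lambda>s. \<Phi> s (Z (k (n + N)) s)) has_integral
          X (k (n + N)) r - X (k (n + N)) (- real N)) {- real N..r}" for n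
        by (rule fundamental_theorem_of_calculus)
          (use r in \<open>auto intro!: has_vector_derivative_within_subset[OF derivN[OF Nk]]\<close>)
      have lim1: "(\<lambda>n. integral {- real N..r} (\<lambda>s. \<Phi> s (Z (k (n + N)) s)))
          \<longlonglongrightarrow> integral {- real N..r} (\<lambda>s. \<Phi> s (x s))"
      proof (rule dominated_convergence(2)[where h = "\<lambda>_. L (real N)"])
        show "(\<lambda>s. \<Phi> s (Z (k (n + N)) s)) integrable_on {- real N..r}" for n
          using int[of n] by blast
        show "norm (\<Phi> s (Z (k (n + N)) s)) \<le> L (real N)" if "s \<in> {- real N..r}" for n s
          by (rule L) (use that r Nk[of n] in \<open>auto intro!: Zbnd\<close>)
        show "(\<lambda>n. \<Phi> s (Z (k (n + N)) s)) \<longlonglongrightarrow> \<Phi> s (x s)" for s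
          by (rule isCont_tendsto_compose[OF \<Phi>isCont LIMSEQ_ignore_initial_segment[OF Zx]])
      qed auto
      have "(\<lambda>n. X (k (n + N)) r - X (k (n + N)) (- real N)) \<longlonglongrightarrow> x r - x (- real N)"
        by (intro tendsto_diff LIMSEQ_ignore_initial_segment[OF x])
      then show ?thesis
        using LIMSEQ_unique[OF lim1[unfolded integral_unique[OF int]]] by (simp add: algebra_simps)
    qed
    have tN: "t \<in> {- real N..real N}" using N by auto
    \<comment> \<open>The limit directly inherits only the integral equation; continuity of
      \<open>x\<close> makes the integrand continuous, so the integral can be
      differentiated.\<close>
    have "((\<lambda>r. x (- real N) + integral {- real N..r} (\<lambda>s. \<Phi> s (x s)))
       has_vector_derivative \<Phi> t (x t)) (at t within {- real N..real N})"
      using has_vector_derivative_add[OF has_vector_derivative_const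
          integral_has_vector_derivative[OF \<Phi>cont[OF xcont] tN]] by simp
    from has_vector_derivative_transform[OF tN eq this]
    have "(x has_vector_derivative \<Phi> t (x t)) (at t within {- real N..real N})" .
    then show ?thesis
      using N by (simp add: at_within_Icc_at)
  qed
  show ?thesis using that deriv_x xS by blast
qed

section \<open>Shooting for a delayed Dirichlet problem\<close>

text \<open>Shooting from \<open>x a = 0\<close> with unknown initial slope \<open>p\<close>. The
  delay lets finitely many integrations produce the solution, which is therefore continuous in
  \<open>p\<close> although \<open>G\<close> is merely continuous. The end condition becomes a
  fixed-point equation for \<open>p\<close>, solved by Brouwer. For
  \<open>t < a + \<epsilon>\<close> the delayed argument is frozen at \<open>a\<close>.\<close>

lemma delayed_dirichlet_problem:
  fixes G :: "real \<Rightarrow> 'a \<Rightarrow> 'a::euclidean_space"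
  assumes cont: "continuous_on UNIV (\<lambda>(t, x). G t x)"
    and bnd: "\<And>t x. norm (G t x) \<le> C" and "a < b" and "\<epsilon> > 0"
  obtains x y where "x a = 0" "x b = 0"
    "\<And>t. t \<in> {a..b} \<Longrightarrow> (x has_vector_derivative y t) (at t within {a..b})"
    "\<And>t. t \<in> {a..b} \<Longrightarrow>
        (y has_vector_derivative G t (x (max a (t - \<epsilon>)))) (at t within {a..b})"
    "\<And>t. t \<in> {a..b} \<Longrightarrow> norm (y t) \<le> 2 * C * (b - a)"
proof -
  have C: "C \<ge> 0" using bnd[of 0 0] norm_ge_zero order_trans by blast
  \<comment> \<open>\<open>Y x\<close> is the gain in slope since \<open>a\<close>; fixed points of
    \<open>T p\<close> solve the delayed equation with value 0 and slope \<open>p\<close> at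
    \<open>a\<close>.\<close>
  define Y where "Y x t = integral {a..t} (\<lambda>s. G s (x (max a (s - \<epsilon>))))" for x t
  define T where "T p x t = (t - a) *\<^sub>R p + integral {a..t} (Y x)" for p x t
  have contG: "continuous_on {a..b} (\<lambda>s. G s (x (max a (s - \<epsilon>))))" if "continuous_on {a..b} x" for x
  proof -
    have "continuous_on {a..b} (\<lambda>s. x (max a (s - \<epsilon>)))"
      by (rule continuous_on_compose2[OF that]) (use \<open>\<epsilon> > 0\<close> in \<open>auto intro!: continuous_intros\<close>)
    from continuous_on_compose2[OF cont continuous_on_Pair[OF continuous_on_id this]]
    show ?thesis by simp
  qed
  have GisCont: "isCont (G s) z" for s z
    using continuous_on_compose2[OF cont, of UNIV "Pair s"]
    by (simp add: continuous_on_eq_continuous_at continuous_intros)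
  have derivY: "(Y x has_vector_derivative G t (x (max a (t - \<epsilon>)))) (at t within {a..b})"
    if "continuous_on {a..b} x" "t \<in> {a..b}" for x t
    unfolding Y_def using integral_has_vector_derivative[OF contG[OF that(1)] that(2)] .
  have contY: "continuous_on {a..b} (Y x)" if "continuous_on {a..b} x" for x
    by (rule continuous_on_vector_derivative[OF derivY[OF that]])
  have derivT: "(T p x has_vector_derivative p + Y x t) (at t within {a..b})"
    if "continuous_on {a..b} x" "t \<in> {a..b}" for p x t
    unfolding T_def
  proof (rule has_vector_derivative_add)
    show "((\<lambda>t. (t - a) *\<^sub>R p) has_vector_derivative p) (at t within {a..b})"
      unfolding has_vector_derivative_def by (auto intro!: derivative_eq_intros)
  qed (rule integral_has_vector_derivative[OF contY[OF that(1)] that(2)])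
  have Ybnd: "norm (Y x t) \<le> C * (b - a)" if "continuous_on {a..b} x" "t \<in> {a..b}" for x t
  proof -
    have "norm (Y x t) \<le> C * (t - a)"
      unfolding Y_def using that by (intro integral_bound continuous_on_subset[OF contG] bnd) auto
    also have "\<dots> \<le> C * (b - a)" using that C by (intro mult_left_mono) auto
    finally show ?thesis .
  qed
  define X where "X k p = (T p ^^ k) (\<lambda>_. 0)" for k p
  have X0: "X 0 p = (\<lambda>_. 0)" and XSuc: "X (Suc k) p = T p (X k p)" for k p
    by (auto simp: X_def)
  have contX: "continuous_on {a..b} (X k p)" for k p
  proof (induction k)
    case (Suc k)
    then show ?case
      unfolding XSuc by (intro continuous_on_vector_derivative[OF derivT])
  qed (simp add: X0)
  \<comment> \<open>At times up to \<open>a + (k + 1) * \<epsilon>\<close> the next iterate consults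
    its argument only up to \<open>a + k * \<epsilon>\<close>, where the induction hypothesis
    already gives agreement.\<close>
  have stab: "X (Suc k) p t = X k p t" if "t \<in> {a..b}" "t \<le> a + real k * \<epsilon>" for k p t
    using that
  proof (induction k arbitrary: t)
    case 0
    then show ?case by (simp add: XSuc X0 T_def)
  next
    case (Suc k)
    have "Y (X (Suc k) p) s = Y (X k p) s" if "s \<in> {a..t}" for s
      unfolding Y_def
    proof (rule integral_cong)
      fix r assume r: "r \<in> {a..s}"
      have "X (Suc k) p (max a (r - \<epsilon>)) = X k p (max a (r - \<epsilon>))"
        by (rule Suc.IH) (use r that Suc.prems \<open>\<epsilon> > 0\<close> in \<open>auto simp: algebra_simps\<close>)
      then show "G r (X (Suc k) p (max a (r - \<epsilon>))) = G r (X k p (max a (r - \<epsilon>)))" by simp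
    qed
    then have "integral {a..t} (Y (X (Suc k) p)) = integral {a..t} (Y (X k p))"
      by (rule integral_cong)
    then show ?case
      by (simp add: XSuc[of "Suc k"] XSuc[of k] T_def)
  qed
  \<comment> \<open>Continuous dependence on the slope: each iterate adds two integrations, and
    dominated convergence with the bounds \<open>C\<close> and \<open>C * (b - a)\<close> carries
    the limit through them.\<close>
  have limX: "(\<lambda>n. X k (p n) t) \<longlonglongrightarrow> X k q t" if "p \<longlonglongrightarrow> q" "t \<in> {a..b}" for k p q t
    using that(2)
  proof (induction k arbitrary: t)
    case (Suc k)
    have limY: "(\<lambda>n. Y (X k (p n)) s) \<longlonglongrightarrow> Y (X k q) s" if s: "s \<in> {a..b}" for s
      unfolding Y_def
    proof (rule dominated_convergence(2)[where h = "\<lambda>_. C"])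
      show "(\<lambda>r. G r (X k (p n) (max a (r - \<epsilon>)))) integrable_on {a..s}" for n
        by (rule integrable_continuous_real, rule continuous_on_subset[OF contG[OF contX]]) (use s in auto)
      show "(\<lambda>n. G r (X k (p n) (max a (r - \<epsilon>)))) \<longlonglongrightarrow> G r (X k q (max a (r - \<epsilon>)))"
        if "r \<in> {a..s}" for r
        by (rule isCont_tendsto_compose[OF GisCont Suc.IH]) (use that s \<open>\<epsilon> > 0\<close> in auto)
    qed (use bnd in auto)
    have "(\<lambda>n. integral {a..t} (Y (X k (p n)))) \<longlonglongrightarrow> integral {a..t} (Y (X k q))"
    proof (rule dominated_convergence(2)[where h = "\<lambda>_. C * (b - a)"])
      show "Y (X k (p n)) integrable_on {a..t}" for n
        by (rule integrable_continuous_real, rule continuous_on_subset[OF contY[OF contX]])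
          (use Suc.prems in auto)
    qed (use Ybnd[OF contX] limY Suc.prems in auto)
    then show ?case
      unfolding XSuc T_def by (intro tendsto_intros that(1))
  qed (simp add: X0)
  \<comment> \<open>The method of steps: each iteration of \<open>T p\<close> extends the exact solution by one delay.\<close>
  obtain K where "(b - a) / \<epsilon> \<le> real K" using real_arch_simple by blast
  then have K: "b \<le> a + real K * \<epsilon>" using \<open>\<epsilon> > 0\<close> by (simp add: field_simps)
  \<comment> \<open>\<open>I p\<close> is the part of the end value caused by \<open>G\<close>: the
    solution ends at \<open>(b - a) *\<^sub>R p + I p\<close>. This vanishes exactly when
    \<open>p\<close> is a fixed point of the map given to Brouwer below, and \<open>Ibnd\<close>
    makes the ball of radius \<open>C * (b - a)\<close> invariant.\<close>
  define I where "I p = integral {a..b} (Y (X K p))" for p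
  have Ibnd: "norm (I p) \<le> C * (b - a) * (b - a)" for p
    unfolding I_def using \<open>a < b\<close> by (intro integral_bound contY[OF contX] Ybnd[OF contX]) auto
  have I: "I p = X (Suc K) p b - (b - a) *\<^sub>R p" for p
    by (simp add: I_def XSuc T_def)
  have contI: "continuous_on UNIV I"
    unfolding I continuous_on_sequentially o_def using \<open>a < b\<close>
    by (auto intro!: tendsto_intros limX)
  obtain p where p: "p \<in> cball 0 (C * (b - a))" "- ((1 / (b - a)) *\<^sub>R I p) = p"
  proof (rule brouwer[of "cball 0 (C * (b - a))" "\<lambda>p. - ((1 / (b - a)) *\<^sub>R I p)"])
    show "continuous_on (cball 0 (C * (b - a))) (\<lambda>p. - ((1 / (b - a)) *\<^sub>R I p))"
      by (intro continuous_intros continuous_on_subset[OF contI]) auto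
    show "(\<lambda>p. - ((1 / (b - a)) *\<^sub>R I p)) \<in> cball 0 (C * (b - a)) \<rightarrow> cball 0 (C * (b - a))"
      using Ibnd \<open>a < b\<close> by (auto simp: field_simps)
  qed (use mult_nonneg_nonneg[OF C, of "b - a"] \<open>a < b\<close> in auto)
  \<comment> \<open>\<open>Suc K\<close> rather than \<open>K\<close> exhibits \<open>x\<close> as
    \<open>T p (X K p)\<close>, so the derivative rules apply; on \<open>{a..b}\<close> the two
    iterates coincide, which closes the equation.\<close>
  define x where "x = X (Suc K) p"
  define y where "y t = p + Y (X K p) t" for t
  have xX: "x t = X K p t" if "t \<in> {a..b}" for t
    unfolding x_def by (rule stab) (use that K in auto)
  show ?thesis
  proof (rule that[of x y])
    show "x a = 0" by (simp add: x_def XSuc T_def)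
    have "(b - a) *\<^sub>R p = - I p"
      using p(2) \<open>a < b\<close> by (metis diff_gt_0_iff_gt divide_self_if less_numeral_extra(3)
        nonzero_mult_div_cancel_left scaleR_minus_right scaleR_one scaleR_scaleR times_divide_eq_right mult.right_neutral)
    then show "x b = 0" using I[of p] by (simp add: x_def)
    fix t assume t: "t \<in> {a..b}"
    show "(x has_vector_derivative y t) (at t within {a..b})"
      unfolding x_def XSuc y_def by (rule derivT[OF contX t])
    have "max a (t - \<epsilon>) \<in> {a..b}" using t \<open>\<epsilon> > 0\<close> by auto
    then show "(y has_vector_derivative G t (x (max a (t - \<epsilon>)))) (at t within {a..b})"
      unfolding y_def
      using has_vector_derivative_add[OF has_vector_derivative_const derivY[OF contX t]] xX by simp
    show "norm (y t) \<le> 2 * C * (b - a)"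
      using norm_triangle_ineq[of p "Y (X K p) t"] p(1) Ybnd[OF contX t, of K p] by (simp add: y_def)
  qed
qed

section \<open>Maximum principle and derivative estimate\<close>

text \<open>At an interior maximum \<open>c\<close> above \<open>K\<close> the slope vanishes and
  \<open>g c > 0\<close>, so the slope is positive just to the right of \<open>c\<close> and
  \<open>u\<close> would rise above its maximum.\<close>

lemma second_order_max_principle:
  fixes u y g :: "real \<Rightarrow> real"
  assumes u: "\<And>t. t \<in> {a..b} \<Longrightarrow> (u has_real_derivative y t) (at t within {a..b})"
    and y: "\<And>t. t \<in> {a..b} \<Longrightarrow> (y has_real_derivative g t) (at t within {a..b})"
    and bdry: "u a \<le> K" "u b \<le> K"
    and pos: "\<And>t. t \<in> {a..b} \<Longrightarrow> u t > K \<Longrightarrow> g t > 0"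
    and t: "t \<in> {a..b}"
  shows "u t \<le> K"
proof -
  have "continuous_on {a..b} u" using u by (meson DERIV_continuous_on)
  then obtain c where c: "c \<in> {a..b}" and cmax: "\<And>s. s \<in> {a..b} \<Longrightarrow> u s \<le> u c"
    using continuous_attains_sup[of "{a..b}" u] t by auto
  have "u c \<le> K"
  proof (rule ccontr)
    assume "\<not> u c \<le> K"
    then have K: "u c > K" by simp
    with bdry c have ab: "a < c" "c < b" by (auto simp: less_le)
    have u': "(u has_real_derivative y s) (at s)" if "a < s" "s < b" for s
      using u[of s] that by (simp add: at_within_Icc_at)
    have y': "(y has_real_derivative g c) (at c)"
      using y[of c] ab by (simp add: at_within_Icc_at)
    have "y c = 0"
      using u'[OF ab]
    proof (rule DERIV_local_max)
      show "0 < min (c - a) (b - c)" using ab by simp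
      show "\<forall>s. \<bar>c - s\<bar> < min (c - a) (b - c) \<longrightarrow> u s \<le> u c"
        by (auto intro!: cmax simp: abs_if split: if_splits)
    qed
    obtain d where d: "d > 0" "\<And>h. 0 < h \<Longrightarrow> h < d \<Longrightarrow> y c < y (c + h)"
      using DERIV_pos_inc_right[OF y' pos[OF c K]] by auto
    define h where "h = min d (b - c) / 2"
    have h: "0 < h" "h < d" "c + h < b" using d ab by (auto simp: h_def min_def field_simps)
    obtain z where z: "c < z" "z < c + h" "u (c + h) - u c = (c + h - c) * y z"
      using MVT2[of c "c + h" u y] u' h ab by auto
    have "y z > 0" using d(2)[of "z - c"] z h \<open>y c = 0\<close> by auto
    then have "u (c + h) > u c" using z h mult_pos_pos[of h "y z"] by (simp del: mult_pos_pos)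
    then show False using cmax[of "c + h"] h ab by auto
  qed
  then show ?thesis using cmax[OF t] by simp
qed

text \<open>Over a unit interval containing \<open>t\<close> the increment of \<open>x\<close>
  differs from \<open>y t\<close> by at most \<open>C\<close>, since \<open>y\<close> stays within
  \<open>C\<close> of \<open>y t\<close> there; the increment itself is at most
  \<open>2 * K\<close>. The bound does not grow with \<open>b - a\<close>.\<close>

lemma derivative_bound_interpolation:
  fixes x y g :: "real \<Rightarrow> 'a::euclidean_space"
  assumes "a + 1 \<le> b"
    and x: "\<And>t. t \<in> {a..b} \<Longrightarrow> (x has_vector_derivative y t) (at t within {a..b})"
    and y: "\<And>t. t \<in> {a..b} \<Longrightarrow> (y has_vector_derivative g t) (at t within {a..b})"
    and xK: "\<And>t. t \<in> {a..b} \<Longrightarrow> norm (x t) \<le> K"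
    and gC: "\<And>t. t \<in> {a..b} \<Longrightarrow> norm (g t) \<le> C"
    and t: "t \<in> {a..b}"
  shows "norm (y t) \<le> 2 * K + C"
proof -
  \<comment> \<open>Left end of a unit window inside \<open>{a..b}\<close> containing
    \<open>t\<close>, pushed back from \<open>b\<close> if necessary.\<close>
  define c where "c = min t (b - 1)"
  have c: "a \<le> c" "c + 1 \<le> b" "t \<in> {c..c + 1}" using assms(1) t by (auto simp: c_def)
  have "norm (x (c + 1) - x c - (c + 1 - c) *\<^sub>R y t) \<le> norm (c + 1 - c) * C"
  proof (rule vector_differentiable_bound_linearization[of "{c..c + 1}"])
    show "(x has_vector_derivative y s) (at s within {c..c + 1})" if "s \<in> {c..c + 1}" for s
      by (rule has_vector_derivative_within_subset[OF x]) (use c that in auto)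
    fix s assume s: "s \<in> {c..c + 1}"
    have "norm (y s - y t) \<le> C * \<bar>s - t\<bar>"
      by (rule has_vector_derivative_bound_Icc[OF y gC]) (use s c t in auto)
    also have "\<dots> \<le> C * 1"
      using s c order_trans[OF norm_ge_zero gC[OF t]] by (intro mult_left_mono) auto
    finally show "norm (y s - y t) \<le> C" by simp
  qed (use c in \<open>auto simp: closed_segment_eq_real_ivl\<close>)
  then have "norm (x (c + 1) - x c - y t) \<le> C" by simp
  moreover have "norm (x (c + 1)) \<le> K" "norm (x c) \<le> K" using c by (auto intro!: xK)
  moreover have "norm (y t) \<le> norm (x (c + 1)) + norm (x c) + norm (x (c + 1) - x c - y t)"
    using norm_triangle_ineq4[of "x (c + 1) - x c" "x (c + 1) - x c - y t"]
      norm_triangle_ineq4[of "x (c + 1)" "x c"] by simp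
  ultimately show ?thesis by linarith
qed

section \<open>Entire solutions for a bounded right-hand side\<close>

text \<open>Delayed Dirichlet solutions on growing intervals, once bounded uniformly, have a
  convergent subsequence whose limit no longer sees the delay. The a priori estimate is required for
  any \<open>z\<close> within distance 1 of \<open>x\<close>, so that it covers the delayed argument
  without mention of \<open>\<epsilon>\<close>.\<close>

lemma bounded_entire_solution:
  fixes G :: "real \<Rightarrow> 'a \<Rightarrow> 'a::euclidean_space"
  assumes cont: "continuous_on UNIV (\<lambda>(t, x). G t x)"
    and bnd: "\<And>t x. norm (G t x) \<le> C"
    and apriori: "\<And>a b x y z t. a < b \<Longrightarrow> x a = 0 \<Longrightarrow> x b = 0 \<Longrightarrow>
      (\<And>t. t \<in> {a..b} \<Longrightarrow> (x has_vector_derivative y t) (at t within {a..b})) \<Longrightarrow>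
      (\<And>t. t \<in> {a..b} \<Longrightarrow> (y has_vector_derivative G t (z t)) (at t within {a..b})) \<Longrightarrow>
      (\<And>t. t \<in> {a..b} \<Longrightarrow> norm (z t - x t) \<le> 1) \<Longrightarrow> t \<in> {a..b} \<Longrightarrow> norm (x t) \<le> B"
  obtains x y where "\<And>t. (x has_vector_derivative y t) (at t)"
    "\<And>t. (y has_vector_derivative G t (x t)) (at t)" "\<And>t. norm (x t) \<le> B"
proof -
  have C: "C \<ge> 0" using bnd[of 0 0] norm_ge_zero order_trans by blast
  \<comment> \<open>The extra 1 gives intervals of length at least 2 even for \<open>n = 0\<close>,
    long enough for the unit window of the derivative estimate.\<close>
  define r where "r n = real n + 1" for n
  \<comment> \<open>The crude slope bound on \<open>{- r n..r n}\<close> is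
    \<open>4 * C * r n\<close>, so this delay moves \<open>x n\<close> by at most
    \<open>1 / r n\<close>, which is both at most 1 and a null sequence. \<open>C + 1\<close> avoids
    division by zero.\<close>
  define \<epsilon> where "\<epsilon> n = 1 / (4 * (C + 1) * (r n)\<^sup>2)" for n
  define \<tau> where "\<tau> n t = max (- r n) (t - \<epsilon> n)" for n t
  have r: "r n \<ge> 1" for n by (simp add: r_def)
  have \<epsilon>: "\<epsilon> n > 0" for n using C r[of n] by (simp add: \<epsilon>_def zero_less_mult_iff)
  have "\<exists>x y. x (- r n) = 0 \<and> x (r n) = 0 \<and>
    (\<forall>t\<in>{- r n..r n}. (x has_vector_derivative y t) (at t within {- r n..r n})) \<and>
    (\<forall>t\<in>{- r n..r n}. (y has_vector_derivative G t (x (\<tau> n t))) (at t within {- r n..r n})) \<and>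
    (\<forall>t\<in>{- r n..r n}. norm (y t) \<le> 4 * C * r n)" for n
  proof -
    have "- r n < r n" using r[of n] by simp
    from delayed_dirichlet_problem[OF cont bnd this \<epsilon>[of n]] obtain x y
      where "x (- r n) = 0" "x (r n) = 0"
        "\<And>t. t \<in> {- r n..r n} \<Longrightarrow> (x has_vector_derivative y t) (at t within {- r n..r n})"
        "\<And>t. t \<in> {- r n..r n} \<Longrightarrow>
          (y has_vector_derivative G t (x (max (- r n) (t - \<epsilon> n)))) (at t within {- r n..r n})"
        "\<And>t. t \<in> {- r n..r n} \<Longrightarrow> norm (y t) \<le> 2 * C * (r n - (- r n))"
      by blast
    then show ?thesis unfolding \<tau>_def by (intro exI[of _ x] exI[of _ y]) (auto simp: algebra_simps)
  qed
  then obtain x y where x0: "\<And>n. x n (- r n) = 0" "\<And>n. x n (r n) = 0"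
    and x: "\<And>n t. t \<in> {- r n..r n} \<Longrightarrow> (x n has_vector_derivative y n t) (at t within {- r n..r n})"
    and y: "\<And>n t. t \<in> {- r n..r n} \<Longrightarrow>
      (y n has_vector_derivative G t (x n (\<tau> n t))) (at t within {- r n..r n})"
    and ybnd: "\<And>n t. t \<in> {- r n..r n} \<Longrightarrow> norm (y n t) \<le> 4 * C * r n"
    by metis
  have close: "norm (x n (\<tau> n t) - x n t) \<le> 1 / r n" if t: "t \<in> {- r n..r n}" for n t
  proof -
    have "norm (x n (\<tau> n t) - x n t) \<le> 4 * C * r n * \<bar>\<tau> n t - t\<bar>"
      by (rule has_vector_derivative_bound_Icc[OF x ybnd]) (use t \<epsilon>[of n] in \<open>auto simp: \<tau>_def\<close>)
    also have "\<dots> \<le> 4 * (C + 1) * r n * \<epsilon> n"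
      using C r[of n] t \<epsilon>[of n] by (intro mult_mono) (auto simp: \<tau>_def)
    also have "\<dots> = 1 / r n"
      using C r[of n] by (simp add: \<epsilon>_def power2_eq_square divide_simps)
    finally show ?thesis .
  qed
  have xB: "norm (x n t) \<le> B" if t: "t \<in> {- r n..r n}" for n t
  proof (rule apriori[OF _ x0 x y _ t])
    show "norm (x n (\<tau> n s) - x n s) \<le> 1" if "s \<in> {- r n..r n}" for s
      using close[OF that] r[of n] by (meson divide_le_eq_1 order_trans linorder_not_less less_le_trans zero_less_one)
  qed (use r[of n] in auto)
  \<comment> \<open>Unlike \<open>ybnd\<close>, this bound is independent of \<open>n\<close>, as
    compactness requires.\<close>
  have yB: "norm (y n t) \<le> 2 * B + C" if "t \<in> {- r n..r n}" for n t
    by (rule derivative_bound_interpolation[OF _ x y xB bnd that]) (use r[of n] in auto)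
  have sub: "{- real n..real n} \<subseteq> {- r n..r n}" for n by (auto simp: r_def)
  define X where "X n t = (x n t, y n t)" for n t
  \<comment> \<open>In the first-order system for position and velocity only the position is
    delayed, so \<open>Z n\<close> and \<open>X n\<close> share their second component.\<close>
  define Z where "Z n t = (x n (\<tau> n t), y n t)" for n t
  obtain W where W: "\<And>t. (W has_vector_derivative (snd (W t), G t (fst (W t)))) (at t)"
    "\<And>t. W t \<in> cball 0 B \<times> cball 0 (2 * B + C)"
  proof (rule limit_of_approximate_solutions[where \<Phi> = "\<lambda>t w. (snd w, G t (fst w))" and X = X and Z = Z
        and \<delta> = "\<lambda>n. 1 / r n" and S = "cball 0 B \<times> cball 0 (2 * B + C)"])
    have "continuous_on UNIV (\<lambda>p. G (fst p) (fst (snd p)))"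
      using continuous_on_compose2[OF cont, of UNIV "\<lambda>p. (fst p, fst (snd p))"]
      by (simp add: continuous_intros)
    then show "continuous_on UNIV (\<lambda>(t, w). (snd w, G t (fst w)))"
      unfolding case_prod_unfold by (intro continuous_intros) auto
    show "compact (cball 0 B \<times> cball 0 (2 * B + C) :: ('a \<times> 'a) set)" by (intro compact_Times) auto
    show "(\<lambda>n. 1 / r n) \<longlonglongrightarrow> 0" unfolding r_def
      using LIMSEQ_Suc[OF lim_1_over_n] by (simp add: add.commute)
    fix n t assume "\<bar>t\<bar> \<le> real n"
    then have t: "t \<in> {- r n..r n}" by (simp add: r_def abs_le_iff)
    show "(X n has_vector_derivative (snd (Z n t), G t (fst (Z n t)))) (at t within {- real n..real n})"
      unfolding X_def Z_def fst_conv snd_conv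
      by (intro has_vector_derivative_Pair has_vector_derivative_within_subset[OF x[OF t] sub]
          has_vector_derivative_within_subset[OF y[OF t] sub])
    show "X n t \<in> cball 0 B \<times> cball 0 (2 * B + C)" using xB[OF t] yB[OF t] by (simp add: X_def)
    show "norm (Z n t - X n t) \<le> 1 / r n" using close[OF t] by (simp add: X_def Z_def norm_Pair)
  qed (rule that)
  show ?thesis
  proof (rule that)
    show "((\<lambda>t. fst (W t)) has_vector_derivative snd (W t)) (at t)" for t
      using bounded_linear.has_vector_derivative[OF bounded_linear_fst W(1)] by simp
    show "((\<lambda>t. snd (W t)) has_vector_derivative G t (fst (W t))) (at t)" for t
      using bounded_linear.has_vector_derivative[OF bounded_linear_snd W(1)] by simp
    show "norm (fst (W t)) \<le> B" for t using W(2)[of t] by (auto simp: mem_Times_iff)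
  qed
qed

section \<open>A priori bounds from coercivity\<close>

text \<open>Where \<open>u > M + 1\<close>, the nearby \<open>w\<close> is still at least
  \<open>M\<close>, so \<open>c t * q t\<close> is at least \<open>H + 1\<close> and outweighs
  \<open>h t\<close>: the second derivative is positive and the maximum principle applies. The lower
  bound follows in the same way for \<open>- u\<close>. The other component of the system is hidden
  in \<open>q\<close>.\<close>

lemma coercive_component_bound:
  fixes u y w q c h :: "real \<Rightarrow> real"
  assumes u: "\<And>t. t \<in> {a..b} \<Longrightarrow> (u has_real_derivative y t) (at t within {a..b})"
    and y: "\<And>t. t \<in> {a..b} \<Longrightarrow> (y has_real_derivative c t * q t + h t) (at t within {a..b})"
    and bdry: "u a = 0" "u b = 0"
    and w: "\<And>t. t \<in> {a..b} \<Longrightarrow> \<bar>w t - u t\<bar> \<le> 1"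
    and c: "0 < c0" "\<And>t. c0 \<le> c t" and h: "\<And>t. \<bar>h t\<bar> \<le> H" and "0 \<le> M"
    and pos: "\<And>t. M \<le> w t \<Longrightarrow> (H + 1) / c0 \<le> q t"
    and neg: "\<And>t. w t \<le> - M \<Longrightarrow> q t \<le> - ((H + 1) / c0)"
    and t: "t \<in> {a..b}"
  shows "\<bar>u t\<bar> \<le> M + 1"
proof -
  have H: "H \<ge> 0" using h[of 0] by linarith
  have *: "c s * e + h' > 0" if "(H + 1) / c0 \<le> e" "\<bar>h'\<bar> \<le> H" for s e h'
  proof -
    have "c0 * ((H + 1) / c0) \<le> c s * e"
      using that c H by (intro mult_mono) (auto intro: order_trans[of 0 c0] less_imp_le)
    then show ?thesis using c that by simp
  qed
  have "u t \<le> M + 1"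
  proof (rule second_order_max_principle[OF u y _ _ _ t])
    show "0 < c s * q s + h s" if "s \<in> {a..b}" "M + 1 < u s" for s
      by (rule *[OF pos h]) (use w[OF that(1)] that in auto)
  qed (use bdry \<open>0 \<le> M\<close> in auto)
  moreover have "- u t \<le> M + 1"
  proof (rule second_order_max_principle[of a b "\<lambda>s. - u s" "\<lambda>s. - y s" "\<lambda>s. - (c s * q s + h s)", OF _ _ _ _ _ t])
    show "0 < - (c s * q s + h s)" if "s \<in> {a..b}" "M + 1 < - u s" for s
    proof -
      have "q s \<le> - ((H + 1) / c0)" by (rule neg) (use w[OF that(1)] that in auto)
      then show ?thesis using *[of "- q s" "- h s" s] h[of s] by simp
    qed
  next
    show "((\<lambda>s. - u s) has_real_derivative - y s) (at s within {a..b})" if "s \<in> {a..b}" for s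
      using DERIV_minus[OF u[OF that]] .
    show "((\<lambda>s. - y s) has_real_derivative - (c s * q s + h s)) (at s within {a..b})"
      if "s \<in> {a..b}" for s
      using DERIV_minus[OF y[OF that]] .
  qed (use bdry \<open>0 \<le> M\<close> in auto)
  ultimately show ?thesis by simp
qed

lemma coercive_threshold:
  fixes f :: "real \<Rightarrow> 'b \<Rightarrow> real"
  assumes top: "\<And>M. \<forall>\<^sub>F x in at_top. \<forall>y. M \<le> f x y"
    and bot: "\<And>M. \<forall>\<^sub>F x in at_bot. \<forall>y. f x y \<le> M"
  obtains m where "\<And>x y. m \<le> x \<Longrightarrow> E \<le> f x y" "\<And>x y. x \<le> - m \<Longrightarrow> f x y \<le> - E"
proof -
  obtain m1 where "\<And>x y. m1 \<le> x \<Longrightarrow> E \<le> f x y"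
    using top[of E] by (auto simp: eventually_at_top_linorder)
  moreover obtain m2 where "\<And>x y. x \<le> m2 \<Longrightarrow> f x y \<le> - E"
    using bot[of "- E"] by (auto simp: eventually_at_bot_linorder)
  ultimately show ?thesis using that[of "max m1 (- m2)"] by simp
qed

lemma C2_on_realsI:
  assumes u: "\<And>t. (u has_real_derivative y t) (at t)"
    and y: "\<And>t. (y has_real_derivative g t) (at t)"
    and "continuous_on UNIV g"
  shows "C2_on_reals u" "deriv (deriv u) = g"
proof -
  have "deriv u = y" using u by (intro ext DERIV_imp_deriv)
  moreover from y have "deriv y = g" by (intro ext DERIV_imp_deriv)
  ultimately show "C2_on_reals u" "deriv (deriv u) = g"
    using assms by (auto simp: C2_on_reals_def field_differentiable_def)
qed

section \<open>Truncation and the coupled system\<close>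

theorem theorem2p2:
  fixes a1 a2 h1 h2 :: "real \<Rightarrow> real"
    and f g fx fy gx gy :: "real \<Rightarrow> real \<Rightarrow> real"
    and c0 c1 \<alpha> :: real
  assumes "continuous_on UNIV a1" and "continuous_on UNIV a2"
    and "0 < c0" and "c0 \<le> c1"
    and "\<And>t. c0 \<le> a1 t \<and> a1 t \<le> c1"
    and "\<And>t. c0 \<le> a2 t \<and> a2 t \<le> c1"
    and "continuous_on UNIV h1" and "continuous_on UNIV h2"
    and "bounded (range h1)" and "bounded (range h2)"
    and "continuous_on UNIV (\<lambda>(x, y). f x y)"
    and "continuous_on UNIV (\<lambda>(x, y). g x y)"
    and "\<And>x y. ((\<lambda>s. f s y) has_real_derivative fx x y) (at x)"
    and "\<And>x y. ((\<lambda>s. f x s) has_real_derivative fy x y) (at y)"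
    and "\<And>x y. ((\<lambda>s. g s y) has_real_derivative gx x y) (at x)"
    and "\<And>x y. ((\<lambda>s. g x s) has_real_derivative gy x y) (at y)"
    and i_top: "\<And>M. \<forall>\<^sub>F x in at_top. \<forall>y. M \<le> f x y"
    and i_bot: "\<And>M. \<forall>\<^sub>F x in at_bot. \<forall>y. f x y \<le> M"
    and ii_top: "\<And>M. \<forall>\<^sub>F y in at_top. \<forall>x. M \<le> g x y"
    and ii_bot: "\<And>M. \<forall>\<^sub>F y in at_bot. \<forall>x. g x y \<le> M"
    and iii: "\<And>x y. \<alpha> \<le> x * f x y \<and> \<alpha> \<le> y * g x y"
    and iv: "\<And>t x y w z. 0 \<le> a1 t * fx x y * w\<^sup>2
                + (a1 t * fy x y + a2 t * gx x y) * w * z + a2 t * gy x y * z\<^sup>2"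
  shows "\<exists>u v. classical_solution a1 a2 f g h1 h2 u v \<and>
               (\<exists>K. \<forall>t. \<bar>u t\<bar> \<le> K \<and> \<bar>v t\<bar> \<le> K)"
proof -
  note a1 = assms(5) and a2 = assms(6)
  obtain H1 where H1: "\<And>t. \<bar>h1 t\<bar> \<le> H1" using assms(9) by (auto simp: bounded_iff)
  obtain H2 where H2: "\<And>t. \<bar>h2 t\<bar> \<le> H2" using assms(10) by (auto simp: bounded_iff)
  define H where "H = max H1 H2"
  have h1: "\<bar>h1 t\<bar> \<le> H" and h2: "\<bar>h2 t\<bar> \<le> H" for t
    using H1[of t] H2[of t] by (auto simp: H_def)
  \<comment> \<open>Once \<open>f\<close> or \<open>g\<close> reaches \<open>E\<close> in absolute
    value, its product with \<open>a1 t\<close> or \<open>a2 t\<close> is at least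
    \<open>c0 * E = H + 1\<close> in absolute value, which exceeds the forcing terms.\<close>
  define E where "E = (H + 1) / c0"
  obtain m1 where m1: "\<And>x y. m1 \<le> x \<Longrightarrow> E \<le> f x y" "\<And>x y. x \<le> - m1 \<Longrightarrow> f x y \<le> - E"
    using coercive_threshold[OF i_top i_bot] by metis
  obtain m2 where m2: "\<And>x y. m2 \<le> y \<Longrightarrow> E \<le> g x y" "\<And>x y. y \<le> - m2 \<Longrightarrow> g x y \<le> - E"
    using coercive_threshold[of "\<lambda>y x. g x y", OF ii_top ii_bot] by metis
  define M where "M = Max {0, m1, m2}"
  have M: "0 \<le> M" "m1 \<le> M" "m2 \<le> M" by (auto simp: M_def)
  \<comment> \<open>Each component will be bounded by \<open>M + 1\<close>, so the norm of the pair
    is at most \<open>B\<close>; truncating at \<open>B\<close> leaves the eventual solution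
    untouched.\<close>
  define B where "B = 2 * (M + 1)"
  define cl where "cl s = max (- B) (min B s)" for s
  have cl_id: "cl s = s" if "\<bar>s\<bar> \<le> B" for s using that by (auto simp: cl_def)
  have cl_range: "cl s \<in> {- B..B}" for s using M by (auto simp: cl_def B_def)
  \<comment> \<open>Since \<open>M \<le> B\<close>, truncation preserves the coercivity
    thresholds.\<close>
  have cl_ge: "M \<le> s \<Longrightarrow> M \<le> cl s" and cl_le: "s \<le> - M \<Longrightarrow> cl s \<le> - M" for s
    using M by (auto simp: cl_def B_def)
  \<comment> \<open>Stated for a generic coefficient, forcing and nonlinearity to serve both
    equations. Boundedness comes from compactness of the square with sides
    \<open>{- B..B}\<close>.\<close>
  have trunc: "continuous_on UNIV (\<lambda>(t, p). c t * k (cl (fst p)) (cl (snd p)) + h t)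
      \<and> (\<exists>D. \<forall>t p. \<bar>c t * k (cl (fst p)) (cl (snd p)) + h t\<bar> \<le> D)"
    if "continuous_on UNIV c" "continuous_on UNIV h" "continuous_on UNIV (\<lambda>(x, y). k x y)"
      "\<And>t. c0 \<le> c t \<and> c t \<le> c1" "\<And>t. \<bar>h t\<bar> \<le> H"
    for c h :: "real \<Rightarrow> real" and k :: "real \<Rightarrow> real \<Rightarrow> real"
  proof
    have "continuous_on UNIV cl" unfolding cl_def by (intro continuous_intros)
    note cl = continuous_on_compose2[OF this]
    show "continuous_on UNIV (\<lambda>(t, p). c t * k (cl (fst p)) (cl (snd p)) + h t)"
      unfolding case_prod_unfold
      by (intro continuous_intros continuous_on_compose2[OF that(1)] continuous_on_compose2[OF that(2)]
          continuous_on_compose2[OF that(3)[unfolded case_prod_unfold], 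
            where f = "\<lambda>q. (cl (fst (snd q)), cl (snd (snd q)))", simplified] cl) auto
    have "compact ((\<lambda>(x, y). k x y) ` ({- B..B} \<times> {- B..B}))"
      by (intro compact_continuous_image continuous_on_subset[OF that(3)] compact_Times) auto
    then obtain K where K: "\<And>z. z \<in> (\<lambda>(x, y). k x y) ` ({- B..B} \<times> {- B..B}) \<Longrightarrow> \<bar>z\<bar> \<le> K"
      by (metis bounded_real compact_imp_bounded)
    have "\<bar>c t * k (cl (fst p)) (cl (snd p)) + h t\<bar> \<le> c1 * K + H" for t p
    proof -
      have "\<bar>k (cl (fst p)) (cl (snd p))\<bar> \<le> K"
        by (rule K, rule image_eqI[of _ _ "(cl (fst p), cl (snd p))"]) (use cl_range in auto)
      then have "\<bar>c t\<bar> * \<bar>k (cl (fst p)) (cl (snd p))\<bar> \<le> c1 * K"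
        using that(4)[of t] \<open>0 < c0\<close> by (intro mult_mono) auto
      then show ?thesis using that(5)[of t] by (simp add: abs_mult[symmetric])
    qed
    then show "\<exists>D. \<forall>t p. \<bar>c t * k (cl (fst p)) (cl (snd p)) + h t\<bar> \<le> D" by blast
  qed
  define F1 where "F1 t p = a1 t * f (cl (fst p)) (cl (snd p)) + h1 t" for t p
  define F2 where "F2 t p = a2 t * g (cl (fst p)) (cl (snd p)) + h2 t" for t p
  obtain D1 where D1: "\<And>t p. \<bar>F1 t p\<bar> \<le> D1" and F1: "continuous_on UNIV (\<lambda>(t, p). F1 t p)"
    using trunc[OF assms(1,7,11) a1 h1] unfolding F1_def by blast
  obtain D2 where D2: "\<And>t p. \<bar>F2 t p\<bar> \<le> D2" and F2: "continuous_on UNIV (\<lambda>(t, p). F2 t p)"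
    using trunc[OF assms(2,8,12) a2 h2] unfolding F2_def by blast
  obtain x y where x: "\<And>t. (x has_vector_derivative y t) (at t)"
    and y: "\<And>t. (y has_vector_derivative (F1 t (x t), F2 t (x t))) (at t)"
    and xB: "\<And>t. norm (x t) \<le> B"
  proof (rule bounded_entire_solution[where G = "\<lambda>t p. (F1 t p, F2 t p)" and C = "D1 + D2" and B = B])
    show "continuous_on UNIV (\<lambda>(t, p). (F1 t p, F2 t p))"
      using continuous_on_Pair[OF F1 F2] by (simp add: case_prod_unfold)
    show "norm (F1 t p, F2 t p) \<le> D1 + D2" for t p
      using norm_Pair_le[of "F1 t p" "F2 t p"] D1[of t p] D2[of t p] by simp
    fix a b t :: real and x y z :: "real \<Rightarrow> real \<times> real"
    assume bdry: "x a = 0" "x b = 0"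
      and x: "\<And>t. t \<in> {a..b} \<Longrightarrow> (x has_vector_derivative y t) (at t within {a..b})"
      and y: "\<And>t. t \<in> {a..b} \<Longrightarrow>
          (y has_vector_derivative (F1 t (z t), F2 t (z t))) (at t within {a..b})"
      and z: "\<And>t. t \<in> {a..b} \<Longrightarrow> norm (z t - x t) \<le> 1" and t: "t \<in> {a..b}"
    \<comment> \<open>The threshold for \<open>f\<close> is uniform in its second argument, so the
      first component is bounded whatever the second one does; the coupling drops out of the
      estimate.\<close>
    have "\<bar>fst (x t)\<bar> \<le> M + 1"
    proof (rule coercive_component_bound[where c = a1 and h = h1 and w = "\<lambda>t. fst (z t)"
          and q = "\<lambda>t. f (cl (fst (z t))) (cl (snd (z t)))" and y = "\<lambda>t. fst (y t)", OF _ _ _ _ _ \<open>0 < c0\<close> _ h1 M(1) _ _ t])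
      fix s assume s: "s \<in> {a..b}"
      show "((\<lambda>t. fst (x t)) has_real_derivative fst (y s)) (at s within {a..b})"
        using bounded_linear.has_vector_derivative[OF bounded_linear_fst x[OF s]]
        by (simp add: has_real_derivative_iff_has_vector_derivative)
      show "((\<lambda>t. fst (y t)) has_real_derivative
          a1 s * f (cl (fst (z s))) (cl (snd (z s))) + h1 s) (at s within {a..b})"
        using bounded_linear.has_vector_derivative[OF bounded_linear_fst y[OF s]]
        by (simp add: has_real_derivative_iff_has_vector_derivative F1_def)
      show "\<bar>fst (z s) - fst (x s)\<bar> \<le> 1"
        using norm_fst_le[of "fst (z s - x s)" "snd (z s - x s)"] z[OF s]
        unfolding prod.collapse by simp
    next
      show "(H + 1) / c0 \<le> f (cl (fst (z s))) (cl (snd (z s)))" if "M \<le> fst (z s)" for s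
        using m1(1) cl_ge[OF that] M unfolding E_def by force
      show "f (cl (fst (z s))) (cl (snd (z s))) \<le> - ((H + 1) / c0)" if "fst (z s) \<le> - M" for s
        using m1(2) cl_le[OF that] M unfolding E_def by force
    qed (use bdry a1 in auto)
    moreover have "\<bar>snd (x t)\<bar> \<le> M + 1"
    proof (rule coercive_component_bound[where c = a2 and h = h2 and w = "\<lambda>t. snd (z t)"
          and q = "\<lambda>t. g (cl (fst (z t))) (cl (snd (z t)))" and y = "\<lambda>t. snd (y t)", OF _ _ _ _ _ \<open>0 < c0\<close> _ h2 M(1) _ _ t])
      fix s assume s: "s \<in> {a..b}"
      show "((\<lambda>t. snd (x t)) has_real_derivative snd (y s)) (at s within {a..b})"
        using bounded_linear.has_vector_derivative[OF bounded_linear_snd x[OF s]]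
        by (simp add: has_real_derivative_iff_has_vector_derivative)
      show "((\<lambda>t. snd (y t)) has_real_derivative
          a2 s * g (cl (fst (z s))) (cl (snd (z s))) + h2 s) (at s within {a..b})"
        using bounded_linear.has_vector_derivative[OF bounded_linear_snd y[OF s]]
        by (simp add: has_real_derivative_iff_has_vector_derivative F2_def)
      show "\<bar>snd (z s) - snd (x s)\<bar> \<le> 1"
        using norm_snd_le[of "snd (z s - x s)" "fst (z s - x s)"] z[OF s]
        unfolding prod.collapse by simp
    next
      show "(H + 1) / c0 \<le> g (cl (fst (z s))) (cl (snd (z s)))" if "M \<le> snd (z s)" for s
        using m2(1) cl_ge[OF that] M unfolding E_def by force
      show "g (cl (fst (z s))) (cl (snd (z s))) \<le> - ((H + 1) / c0)" if "snd (z s) \<le> - M" for s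
        using m2(2) cl_le[OF that] M unfolding E_def by force
    qed (use bdry a2 in auto)
    ultimately show "norm (x t) \<le> B"
      using norm_Pair_le[of "fst (x t)" "snd (x t)"] by (simp add: B_def)
  qed (rule that)
  define u where "u t = fst (x t)" for t
  define v where "v t = snd (x t)" for t
  have uB: "\<bar>u t\<bar> \<le> B" and vB: "\<bar>v t\<bar> \<le> B" for t
    using norm_fst_le[of "u t" "v t"] norm_snd_le[of "v t" "u t"] xB[of t] by (auto simp: u_def v_def)
  \<comment> \<open>Within the bound \<open>B\<close> the truncation is the identity, so the
    original right-hand sides reappear.\<close>
  have F1_eq: "F1 t (x t) = a1 t * f (u t) (v t) + h1 t"
    and F2_eq: "F2 t (x t) = a2 t * g (u t) (v t) + h2 t" for t
    using cl_id[OF uB[of t]] cl_id[OF vB[of t]] by (auto simp: F1_def F2_def u_def v_def)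
  have xcont: "continuous_on UNIV x"
    using x by (rule continuous_on_vector_derivative)
  have contF: "continuous_on UNIV (\<lambda>t. F1 t (x t))" "continuous_on UNIV (\<lambda>t. F2 t (x t))"
    using continuous_on_compose2[OF F1 continuous_on_Pair[OF continuous_on_id xcont]]
      continuous_on_compose2[OF F2 continuous_on_Pair[OF continuous_on_id xcont]] by simp_all
  have u: "(u has_real_derivative fst (y t)) (at t)"
    and v: "(v has_real_derivative snd (y t)) (at t)"
    and u': "((\<lambda>t. fst (y t)) has_real_derivative F1 t (x t)) (at t)"
    and v': "((\<lambda>t. snd (y t)) has_real_derivative F2 t (x t)) (at t)" for t
    using bounded_linear.has_vector_derivative[OF bounded_linear_fst x]
      bounded_linear.has_vector_derivative[OF bounded_linear_snd x]
      bounded_linear.has_vector_derivative[OF bounded_linear_fst y]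
      bounded_linear.has_vector_derivative[OF bounded_linear_snd y]
    by (simp_all add: has_real_derivative_iff_has_vector_derivative u_def[abs_def] v_def[abs_def])
  have "classical_solution a1 a2 f g h1 h2 u v"
    using C2_on_realsI[OF u u' contF(1)] C2_on_realsI[OF v v' contF(2)]
    by (simp add: classical_solution_def F1_eq F2_eq)
  then show ?thesis using uB vB by blast
qed

end
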